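(* Let $d\ge 1$, $r\ge 1$ and $n_1,\ldots,n_d\ge 3$ be integers, and let $\emptyset\neq\mathcal{A}\subseteq\mathbb{Z}_2^{d+r}\setminus\{\mathbf{0}\}$. Suppose that $\mathcal{A}$ contains at least one element whose last $r$ coordinates are not all $0$ and at least one element whose first $d$ coordinates are not all $0$. Write $\mathbf{c}(\mathcal{A})=(b_1,\ldots,b_d,b_{d+1},\ldots,b_{d+r})$ and $\mathbf{c}(\mathcal{A}_{-}(\mathbf{0}))=(c_{d+1},\ldots,c_{d+r})$. Let $G=\mathrm{NEPS}(K_{n_1},\ldots,K_{n_d},r\odot K_2;\mathcal{A})$ and $h=\gcd(n_1,\ldots,n_d)$. (a) Suppose $h$ is odd. Then $G$ is periodic with period $2\pi$. Moreover, if every $\mathbf{a}\in\mathcal{A}^*\setminus\{\mathbf{0}\}$ satisfies $|\mathcal{A}_{-}(\mathbf{a})|\equiv 0\pmod 4$ and $\mathbf{c}(\mathcal{A}_{-}(\mathbf{a}))=\mathbf{0}$, then: (a.i) if $(c_{d+1},\ldots,c_{d+r})\ne\mathbf{0}$, $G$ admits PST from $\mathbf{u}$ to $\mathbf{u}+(0,\ldots,0,c_{d+1},\ldots,c_{d+r})$ at time $\frac{\pi}{2}$ for every vertex $\mathbf{u}$; (a.ii) if $(c_{d+1},\ldots,c_{d+r})=\mathbf{0}$, $G$ is periodic with period $\frac{\pi}{2}$. (b) Suppose $h$ is even. Then $G$ is periodic with period $\pi$. Moreover, if $h$ is not a multiple of $4$ and every $\mathbf{a}\in\mathcal{A}^*\setminus\{\mathbf{0}\}$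 satisfies $|\mathcal{A}_{-}(\mathbf{a})|\equiv 0\pmod 2$ and $\mathbf{c}(\mathcal{A}_{-}(\mathbf{a}))=\mathbf{0}$, then: (b.i) if $(c_{d+1},\ldots,c_{d+r})\ne\mathbf{0}$, $G$ admits PST from $\mathbf{u}$ to $\mathbf{u}+(0,\ldots,0,c_{d+1},\ldots,c_{d+r})$ at time $\frac{\pi}{2}$ for every vertex $\mathbf{u}$; (b.ii) if $(c_{d+1},\ldots,c_{d+r})=\mathbf{0}$, $G$ is periodic with period $\frac{\pi}{2}$. (c) Suppose $h$ is a multiple of $4$. Then: (c.i) if $(b_{d+1},\ldots,b_{d+r})\ne\mathbf{0}$, $G$ admits PST from $\mathbf{u}$ to $\mathbf{u}+(0,\ldots,0,b_{d+1},\ldots,b_{d+r})$ at time $\frac{\pi}{2}$ for every vertex $\mathbf{u}$; (c.ii) if $(b_{d+1},\ldots,b_{d+r})=\mathbf{0}$, $G$ is periodic with period $\frac{\pi}{2}$.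
   Context: For a graph $G$ with adjacency matrix $A_G$, its transition matrix is $H_{A_G}(t)=\exp(-\mathrm{i}tA_G)$, $t\in\mathbb{R}$. Perfect state transfer (PST) from $u$ to $v$ at time $\tau$ means $u\ne v$ and $|H_{A_G}(\tau)_{u,v}|=1$. $G$ is periodic with period $\tau$ if $|H_{A_G}(\tau)_{u,u}|=1$ for every vertex $u$. For graphs $G_1,\ldots,G_m$ and $\emptyset\ne\mathcal{B}\subseteq\mathbb{Z}_2^m\setminus\{\mathbf{0}\}$, $\mathrm{NEPS}(G_1,\ldots,G_m;\mathcal{B})$ is the graph with vertex set $V(G_1)\times\cdots\times V(G_m)$ in which $(u_1,\ldots,u_m)$ and $(v_1,\ldots,v_m)$ are adjacent iff there is $(a_1,\ldots,a_m)\in\mathcal{B}$ with $u_i=v_i$ whenever $a_i=0$ and $u_i\sim v_i$ in $G_i$ whenever $a_i=1$. $\mathrm{NEPS}(K_{n_1},\ldots,K_{n_d},r\odot K_2;\mathcal{A})$ is the NEPS of $K_{n_1},\ldots,K_{n_d}$ followed by $r$ copies of $K_2$. Vertices of $K_{n_i}$ are identified with $\mathbb{Z}_{n_i}$ and those of $K_2$ with $\mathbb{Z}_2$; for a vertex $\mathbf{u}$ and $\mathbf{a}\in\mathbb{Z}_2^{d+r}$, $\mathbf{u}+\mathbf{a}$ is coordinatewise addition, modulo $n_i$ in coordinate $i\le d$ and modulo $2$ in the last $r$ coordinates. For $\mathcal{B}\subseteq\mathbb{Z}_2^m$, $\mathbf{c}(\mathcal{B})=\sum_{\mathbf{a}\in\mathcal{B}}\mathbf{a}$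 computed in $\mathbb{Z}_2^m$ (so $\mathbf{c}(\emptyset)=\mathbf{0}$). Define $\mathcal{A}^*=\{(a_1,\ldots,a_d):(a_1,\ldots,a_{d+r})\in\mathcal{A}\}$ and, for $\mathbf{a}\in\mathbb{Z}_2^d$, $\mathcal{A}_{-}(\mathbf{a})=\{(x_{d+1},\ldots,x_{d+r}):(x_1,\ldots,x_{d+r})\in\mathcal{A},\ (x_1,\ldots,x_d)=\mathbf{a}\}$. *)

theory Defs
  imports "HOL-Analysis.Analysis" "HOL-Library.Z2" "Graph_Theory.Kuratowski"
begin

text \<open>
  The vertex set of a NEPS depends on natural number parameters, so square complex matrices are
  functions of two arguments, used only on a finite index set \<open>V\<close>. The matrix exponential is
  the entrywise sum of the exponential series; it converges absolutely, see
  \<open>norm_summable_mat_exp_on\<close>. A finite simple graph is a \<^const>\<open>pair_graph\<close>.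
\<close>

primrec mat_pow_on :: "'a set \<Rightarrow> ('a \<Rightarrow> 'a \<Rightarrow> complex) \<Rightarrow> nat \<Rightarrow> 'a \<Rightarrow> 'a \<Rightarrow> complex" where
  "mat_pow_on V M 0 = (\<lambda>u v. of_bool (u = v))"
| "mat_pow_on V M (Suc k) = (\<lambda>u v. \<Sum>w\<in>V. M u w * mat_pow_on V M k w v)"

definition mat_exp_on :: "'a set \<Rightarrow> ('a \<Rightarrow> 'a \<Rightarrow> complex) \<Rightarrow> 'a \<Rightarrow> 'a \<Rightarrow> complex" where
  "mat_exp_on V M u v = (\<Sum>k. mat_pow_on V M k u v /\<^sub>R fact k)"

definition adj_matrix :: "'a pair_pre_digraph \<Rightarrow> 'a \<Rightarrow> 'a \<Rightarrow> complex" where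
  "adj_matrix G u v = of_bool ((u, v) \<in> parcs G)"

definition transition_matrix :: "'a pair_pre_digraph \<Rightarrow> real \<Rightarrow> 'a \<Rightarrow> 'a \<Rightarrow> complex" where
  "transition_matrix G t = mat_exp_on (pverts G) (\<lambda>u v. - \<i> * of_real t * adj_matrix G u v)"

definition PST :: "'a pair_pre_digraph \<Rightarrow> 'a \<Rightarrow> 'a \<Rightarrow> real \<Rightarrow> bool" where
  "PST G u v \<tau> \<longleftrightarrow> u \<in> pverts G \<and> v \<in> pverts G \<and> u \<noteq> v \<and> norm (transition_matrix G \<tau> u v) = 1"

definition periodic_graph :: "'a pair_pre_digraph \<Rightarrow> real \<Rightarrow> bool" where
  "periodic_graph G \<tau> \<longleftrightarrow> (\<forall>u\<in>pverts G. norm (transition_matrix G \<tau> u u) = 1)"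

definition complete_graph :: "nat \<Rightarrow> nat pair_pre_digraph" where
  "complete_graph n = \<lparr>pverts = {0..<n}, parcs = {(u, v). u < n \<and> v < n \<and> u \<noteq> v}\<rparr>"

definition Z2_space :: "nat \<Rightarrow> bit list set" where
  "Z2_space m = {a. length a = m}"

definition Z2_zero :: "nat \<Rightarrow> bit list" where
  "Z2_zero m = replicate m 0"

definition NEPS :: "'a pair_pre_digraph list \<Rightarrow> bit list set \<Rightarrow> 'a list pair_pre_digraph" where
  "NEPS Gs B =
    (let m = length Gs; V = {u. length u = m \<and> (\<forall>i<m. u ! i \<in> pverts (Gs ! i))} in
     \<lparr>pverts = V,
      parcs = {(u, v). u \<in> V \<and> v \<in> V \<and>
        (\<exists>a\<in>B. \<forall>i<m. (a ! i = 0 \<longrightarrow> u ! i = v ! i) \<and>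
                      (a ! i = 1 \<longrightarrow> (u ! i, v ! i) \<in> parcs (Gs ! i)))}\<rparr>)"

definition vec_sum :: "nat \<Rightarrow> bit list set \<Rightarrow> bit list" where
  "vec_sum m B = map (\<lambda>i. \<Sum>a\<in>B. a ! i) [0..<m]"

definition proj_first :: "nat \<Rightarrow> bit list set \<Rightarrow> bit list set" where
  "proj_first d A = take d ` A"

definition fibre :: "nat \<Rightarrow> bit list set \<Rightarrow> bit list \<Rightarrow> bit list set" where
  "fibre d A a = {drop d x | x. x \<in> A \<and> take d x = a}"

text \<open>Coordinate \<open>i\<close> is added modulo the \<open>i\<close>-th entry of the list of moduli \<open>N\<close>.\<close>

definition translate :: "nat list \<Rightarrow> nat list \<Rightarrow> bit list \<Rightarrow> nat list" where
  "translate N u a = map (\<lambda>i. (u ! i + of_bool (a ! i = 1)) mod (N ! i)) [0..<length N]"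

lemma norm_summable_mat_exp_on:
  assumes V: "finite V" and "u \<in> V" "v \<in> V"
  shows "summable (\<lambda>k. norm (mat_pow_on V M k u v /\<^sub>R fact k))"
proof -
  define S where "S = (\<Sum>x\<in>V. \<Sum>w\<in>V. norm (M x w))"
  have S0: "S \<ge> 0"
    unfolding S_def by (intro sum_nonneg) auto
  have bnd: "norm (mat_pow_on V M k x v) \<le> S ^ k" if "x \<in> V" for k x
    using that
  proof (induction k arbitrary: x)
    case (Suc k)
    have "norm (mat_pow_on V M (Suc k) x v) \<le> (\<Sum>w\<in>V. norm (M x w) * norm (mat_pow_on V M k w v))"
      by (simp add: sum_norm_le norm_mult)
    also have "\<dots> \<le> (\<Sum>w\<in>V. norm (M x w) * S ^ k)"
      using Suc.IH by (intro sum_mono mult_left_mono) auto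
    also have "\<dots> = (\<Sum>w\<in>V. norm (M x w)) * S ^ k"
      by (simp add: sum_distrib_right)
    also have "\<dots> \<le> S * S ^ k"
      unfolding S_def using V Suc.prems S0
      by (intro mult_right_mono member_le_sum) (auto intro: sum_nonneg simp: S_def)
    finally show ?case by simp
  qed simp
  have "summable (\<lambda>k. S ^ k /\<^sub>R fact k)"
    by (rule summable_exp_generic)
  then show ?thesis
    by (rule summable_comparison_test')
      (use bnd[OF \<open>u \<in> V\<close>] in \<open>auto simp: field_simps intro!: divide_right_mono\<close>)
qed

lemma pair_graph_complete_graph: "pair_graph (complete_graph n)"
proof -
  have "finite {(u, v). u < n \<and> v < n \<and> u \<noteq> v}"
    by (rule finite_subset[of _ "{..<n} \<times> {..<n}"]) auto
  then show ?thesis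
    by unfold_locales (auto simp: complete_graph_def symmetric_def sym_def)
qed

lemma complete_digraph_complete_graph: "complete_digraph n (with_proj (complete_graph n))"
  using pair_graph.pair_graphD_graph[OF pair_graph_complete_graph]
  by (auto simp: complete_digraph_def complete_graph_def)

lemma pair_graph_NEPS:
  assumes Gs: "\<And>G. G \<in> set Gs \<Longrightarrow> pair_graph G"
    and B: "B \<subseteq> Z2_space (length Gs) - {Z2_zero (length Gs)}"
  shows "pair_graph (NEPS Gs B)"
proof -
  let ?m = "length Gs"
  let ?V = "pverts (NEPS Gs B)"
  have V: "?V = {u. length u = ?m \<and> (\<forall>i<?m. u ! i \<in> pverts (Gs ! i))}"
    by (simp add: NEPS_def Let_def)
  have "?V \<subseteq> {u. set u \<subseteq> (\<Union>G\<in>set Gs. pverts G) \<and> length u = ?m}"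
    unfolding V by (force simp: in_set_conv_nth)
  moreover have "finite (\<Union>G\<in>set Gs. pverts G)"
    using Gs by (auto simp: pair_graph_def pair_digraph_def pair_fin_digraph_def pair_fin_digraph_axioms_def)
  ultimately have finV: "finite ?V"
    using finite_subset[OF _ finite_lists_length_eq] by blast
  have sub: "parcs (NEPS Gs B) \<subseteq> ?V \<times> ?V"
    by (auto simp: NEPS_def Let_def)
  have symG: "(y, x) \<in> parcs (Gs ! i)" if "(x, y) \<in> parcs (Gs ! i)" "i < ?m" for x y i
  proof -
    interpret pair_graph "Gs ! i" using Gs that(2) by simp
    show ?thesis using that(1) pair_sym_arcs by (auto simp: symmetric_def sym_def)
  qed
  have irr: "(x, x) \<notin> parcs (Gs ! i)" if "i < ?m" for x i
  proof -
    interpret pair_graph "Gs ! i" using Gs that by simp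
    show ?thesis using pair_no_loops by force
  qed
  have nz: "\<exists>i<?m. a ! i = 1" if "a \<in> B" for a
  proof (rule ccontr)
    assume "\<not> ?thesis"
    then have "a = Z2_zero ?m"
      using B that unfolding Z2_zero_def Z2_space_def
      by (intro nth_equalityI) auto
    then show False using B that by auto
  qed
  show ?thesis
  proof unfold_locales
    show "symmetric (with_proj (NEPS Gs B))"
      unfolding symmetric_def sym_def using symG
      by (auto simp: NEPS_def Let_def) metis
    show "fst e \<noteq> snd e" if "e \<in> parcs (NEPS Gs B)" for e
      using that nz irr by (fastforce simp: NEPS_def Let_def)
  qed (use sub finV finite_subset in auto)
qed

end

theory Submission
  imports Defs "HOL-Number_Theory.Cong"
begin

text \<open>
  The adjacency matrix of \<open>K\<^sub>n\<close> has the spectral idempotents \<open>J / n\<close> (eigenvalue \<open>n - 1\<close>) and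
  \<open>I - J / n\<close> (eigenvalue \<open>- 1\<close>). Tensor products of these, indexed by \<open>s\<close>, diagonalise a NEPS of
  complete graphs, with integer eigenvalues
  \<open>\<lambda>\<^sub>s = (\<Sum>a\<in>B. \<Prod>i | a\<^sub>i = 1. (n\<^sub>i - 1 or - 1))\<close>. On \<open>K\<^sub>2\<close> the difference of the two idempotents is
  the swap of the two vertices; hence, if \<open>exp (- \<i> t \<lambda>\<^sub>s)\<close> is a constant phase times a character
  \<open>\<plusminus>1\<close> in the \<open>K\<^sub>2\<close>-components of \<open>s\<close>, then the transition matrix is, up to that phase, the
  translation by the vector of the character. At \<open>t = \<pi> / 2\<close> the phase depends only on \<open>\<lambda>\<^sub>s\<close>
  modulo 4.
\<close>

section \<open>Spectral form of the matrix exponential, and sums over tuples\<close>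

text \<open>Everything happens in column \<open>v\<close>: the vectors \<open>P s _ v\<close> are
  eigenvectors of \<open>M\<close> that add up to the unit vector at \<open>v\<close>. Hence column
  \<open>v\<close> of each power of \<open>M\<close> is the same sum weighted by powers of the
  eigenvalues, and the exponential series can be summed separately for each
  \<open>s\<close>.\<close>

lemma mat_exp_on_spectral:
  fixes P :: "'s \<Rightarrow> 'a \<Rightarrow> 'a \<Rightarrow> complex"
  assumes S: "finite S" and u: "u \<in> V"
    and eig: "\<And>s x. s \<in> S \<Longrightarrow> x \<in> V \<Longrightarrow> (\<Sum>w\<in>V. M x w * P s w v) = l s * P s x v"
    and res: "\<And>x. x \<in> V \<Longrightarrow> (\<Sum>s\<in>S. P s x v) = of_bool (x = v)"
  shows "mat_exp_on V M u v = (\<Sum>s\<in>S. exp (l s) * P s u v)"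
proof -
  have pow: "mat_pow_on V M k x v = (\<Sum>s\<in>S. l s ^ k * P s x v)" if "x \<in> V" for k x
    using that
  proof (induction k arbitrary: x)
    case (Suc k)
    have "mat_pow_on V M (Suc k) x v = (\<Sum>w\<in>V. \<Sum>s\<in>S. l s ^ k * (M x w * P s w v))"
      using Suc.IH by (simp add: sum_distrib_left mult_ac)
    also have "\<dots> = (\<Sum>s\<in>S. l s ^ k * (\<Sum>w\<in>V. M x w * P s w v))"
      by (subst sum.swap) (simp add: sum_distrib_left)
    also have "\<dots> = (\<Sum>s\<in>S. l s ^ Suc k * P s x v)"
      using Suc.prems by (intro sum.cong) (simp_all add: eig)
    finally show ?case .
  qed (simp add: res)
  have "(\<lambda>k. \<Sum>s\<in>S. l s ^ k /\<^sub>R fact k * P s u v) sums (\<Sum>s\<in>S. exp (l s) * P s u v)"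
    by (intro sums_sum sums_mult2 exp_converges)
  moreover have "(\<Sum>s\<in>S. l s ^ k /\<^sub>R fact k * P s u v) = mat_pow_on V M k u v /\<^sub>R fact k" for k
    using pow[OF u] by (simp add: scaleR_sum_right)
  ultimately show ?thesis
    unfolding mat_exp_on_def by (simp add: sums_unique[symmetric])
qed

text \<open>Vertices of a NEPS are lists, while distributivity is available for choice functions in
  \<open>PiE\<close>; the bijection between the two lets sums over the vertex set factor over the
  coordinates.\<close>

lemma sum_lists_prod:
  fixes f :: "nat \<Rightarrow> 'a \<Rightarrow> 'b::comm_semiring_1"
  assumes "\<And>i. i < m \<Longrightarrow> finite (S i)"
  shows "(\<Sum>w | length w = m \<and> (\<forall>i<m. w ! i \<in> S i). \<Prod>i<m. f i (w ! i)) = (\<Prod>i<m. \<Sum>x\<in>S i. f i x)"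
proof -
  have "(\<Prod>i<m. \<Sum>x\<in>S i. f i x) = (\<Sum>g\<in>PiE {..<m} S. \<Prod>i<m. f i (g i))"
    using assms by (intro prod_sum_PiE) auto
  also have "\<dots> = (\<Sum>w | length w = m \<and> (\<forall>i<m. w ! i \<in> S i). \<Prod>i<m. f i (w ! i))"
    by (rule sum.reindex_bij_witness[where i = "\<lambda>w. restrict ((!) w) {..<m}" and j = "\<lambda>g. map g [0..<m]"])
      (auto simp: PiE_iff extensional_def fun_eq_iff intro!: nth_equalityI)
  finally show ?thesis by simp
qed

section \<open>Spectra of complete graphs and of their NEPS\<close>

text \<open>\<open>True\<close> labels the space of constant vectors, \<open>False\<close> that of
  vectors with coordinate sum 0.\<close>

definition complete_eigenvalue :: "nat \<Rightarrow> bool \<Rightarrow> int" where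
  "complete_eigenvalue n s = (if s then int n - 1 else - 1)"

definition complete_idempotent :: "nat \<Rightarrow> bool \<Rightarrow> nat \<Rightarrow> nat \<Rightarrow> complex" where
  "complete_idempotent n s x y = (if s then 1 / of_nat n else of_bool (x = y) - 1 / of_nat n)"

lemma complete_eigenvalue_two [simp]: "complete_eigenvalue 2 s = (if s then 1 else - 1)"
  by (simp add: complete_eigenvalue_def)

lemma sum_complete_idempotent:
  assumes "y < n"
  shows "(\<Sum>z<n. complete_idempotent n s z y) = of_bool s"
  using assms by (auto simp: complete_idempotent_def sum_subtractf of_bool_def)

text \<open>The adjacency matrix is \<open>J - I\<close>, so the left side is a full column sum of
  the idempotent minus its entry at \<open>x\<close>.\<close>

lemma complete_idempotent_eigen:
  assumes "x < n" "y < n"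
  shows "(\<Sum>z<n. of_bool (x \<noteq> z) * complete_idempotent n s z y)
    = of_int (complete_eigenvalue n s) * complete_idempotent n s x y"
proof -
  have "(\<Sum>z<n. of_bool (x \<noteq> z) * complete_idempotent n s z y)
      = (\<Sum>z<n. complete_idempotent n s z y - (if x = z then complete_idempotent n s z y else 0))"
    by (intro sum.cong) auto
  also have "\<dots> = of_bool s - complete_idempotent n s x y"
    using assms by (simp add: sum_subtractf sum_complete_idempotent)
  also have "\<dots> = of_int (complete_eigenvalue n s) * complete_idempotent n s x y"
    using assms by (auto simp: complete_eigenvalue_def complete_idempotent_def field_simps)
  finally show ?thesis .
qed

text \<open>Eigenvalue of the tensor product with adjacency matrices where \<open>a ! i = 1\<close>
  and identities elsewhere. If the moduli are 2 wherever \<open>a ! i = 1\<close>, it is also a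
  sign: the character of \<open>s\<close> that belongs to \<open>a\<close>.\<close>

definition tensor_eigenvalue :: "nat list \<Rightarrow> bit list \<Rightarrow> (nat \<Rightarrow> bool) \<Rightarrow> int" where
  "tensor_eigenvalue N a s =
    (\<Prod>i<length N. if a ! i = 1 then complete_eigenvalue (N ! i) (s i) else 1)"

definition NEPS_eigenvalue :: "nat list \<Rightarrow> bit list set \<Rightarrow> (nat \<Rightarrow> bool) \<Rightarrow> int" where
  "NEPS_eigenvalue N B s = (\<Sum>a\<in>B. tensor_eigenvalue N a s)"

lemma pverts_NEPS_complete:
  "pverts (NEPS (map complete_graph N) B) = {u. length u = length N \<and> (\<forall>i<length N. u ! i \<in> {..<N ! i})}"
  by (auto simp: NEPS_def Let_def complete_graph_def)

lemma finite_Z2_subset: "B \<subseteq> Z2_space m \<Longrightarrow> finite B"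
  by (rule finite_subset[OF _ finite_lists_length_eq[of "{0, 1}" m]]) (auto simp: Z2_space_def)

text \<open>In a complete graph, adjacent means distinct. So the only element of \<open>B\<close>
  that can witness an arc is the vector \<open>e\<close> marking the coordinates where
  \<open>u\<close> and \<open>v\<close> differ, and at most one summand is nonzero.\<close>

lemma adj_matrix_NEPS_complete:
  assumes B: "B \<subseteq> Z2_space (length N)"
    and u: "u \<in> pverts (NEPS (map complete_graph N) B)"
    and v: "v \<in> pverts (NEPS (map complete_graph N) B)"
  shows "adj_matrix (NEPS (map complete_graph N) B) u v
    = (\<Sum>a\<in>B. \<Prod>i<length N. if a ! i = 1 then of_bool (u ! i \<noteq> v ! i) else of_bool (u ! i = v ! i))"
proof -
  define e :: "bit list" where "e = map (\<lambda>i. if u ! i = v ! i then 0 else 1) [0..<length N]"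
  have eq: "(\<forall>i<length N. (a ! i = 1) = (u ! i \<noteq> v ! i)) \<longleftrightarrow> a = e" if "a \<in> B" for a
  proof -
    have "length a = length N"
      using that B by (auto simp: Z2_space_def)
    then have "a = e \<longleftrightarrow> (\<forall>i<length N. a ! i = e ! i)"
      by (subst list_eq_iff_nth_eq) (simp add: e_def)
    moreover have "a ! i = e ! i \<longleftrightarrow> (a ! i = 1) = (u ! i \<noteq> v ! i)" if "i < length N" for i
      using that by (cases "a ! i = 1") (simp_all add: e_def)
    ultimately show ?thesis by simp
  qed
  have arc: "(u, v) \<in> parcs (NEPS (map complete_graph N) B) \<longleftrightarrow> e \<in> B"
  proof -
    have coord: "((a ! i = 0 \<longrightarrow> u ! i = v ! i) \<and>
          (a ! i = 1 \<longrightarrow> (u ! i, v ! i) \<in> parcs (map complete_graph N ! i)))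
        \<longleftrightarrow> (a ! i = 1) = (u ! i \<noteq> v ! i)" if "i < length N" for a :: "bit list" and i
      using u v that by (cases "a ! i = 1") (auto simp: pverts_NEPS_complete complete_graph_def)
    have "(u, v) \<in> parcs (NEPS (map complete_graph N) B)
        \<longleftrightarrow> u \<in> pverts (NEPS (map complete_graph N) B) \<and> v \<in> pverts (NEPS (map complete_graph N) B) \<and>
          (\<exists>a\<in>B. \<forall>i<length N. (a ! i = 0 \<longrightarrow> u ! i = v ! i) \<and>
            (a ! i = 1 \<longrightarrow> (u ! i, v ! i) \<in> parcs (map complete_graph N ! i)))"
      by (simp add: NEPS_def Let_def)
    also have "\<dots> \<longleftrightarrow> (\<exists>a\<in>B. \<forall>i<length N. (a ! i = 1) = (u ! i \<noteq> v ! i))"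
      using u v coord by simp
    also have "\<dots> \<longleftrightarrow> e \<in> B"
      using eq by auto
    finally show ?thesis .
  qed
  have "(\<Sum>a\<in>B. \<Prod>i<length N. if a ! i = 1 then of_bool (u ! i \<noteq> v ! i) else of_bool (u ! i = v ! i))
      = (\<Sum>a\<in>B. of_bool (a = e) :: complex)"
  proof (rule sum.cong)
    fix a assume a: "a \<in> B"
    have "(\<Prod>i<length N. if a ! i = 1 then of_bool (u ! i \<noteq> v ! i) else of_bool (u ! i = v ! i))
        = (\<Prod>i<length N. of_bool ((a ! i = 1) = (u ! i \<noteq> v ! i)) :: complex)"
      by (intro prod.cong) auto
    also have "\<dots> = of_bool (\<forall>i<length N. (a ! i = 1) = (u ! i \<noteq> v ! i))"
      by (auto simp: of_bool_def prod_zero_iff)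
    finally show "(\<Prod>i<length N. if a ! i = 1 then of_bool (u ! i \<noteq> v ! i) else of_bool (u ! i = v ! i))
        = (of_bool (a = e) :: complex)"
      using eq[OF a] by simp
  qed simp
  also have "\<dots> = of_bool (e \<in> B)"
    using finite_Z2_subset[OF B] by (simp add: of_bool_def)
  finally show ?thesis
    using arc by (simp add: adj_matrix_def)
qed

text \<open>The tensor products belonging to different \<open>a\<close> share the eigenvectors built
  from one idempotent per coordinate, so their eigenvalues add up. Taking \<open>s\<close> from
  \<open>PiE\<close> lists each choice of idempotents exactly once.\<close>

lemma transition_matrix_NEPS_complete:
  assumes B: "B \<subseteq> Z2_space (length N)"
    and u: "u \<in> pverts (NEPS (map complete_graph N) B)"
    and v: "v \<in> pverts (NEPS (map complete_graph N) B)"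
  shows "transition_matrix (NEPS (map complete_graph N) B) t u v
    = (\<Sum>s\<in>PiE {..<length N} (\<lambda>_. UNIV). exp (- \<i> * of_real t * of_int (NEPS_eigenvalue N B s))
        * (\<Prod>i<length N. complete_idempotent (N ! i) (s i) (u ! i) (v ! i)))"
proof -
  define m where "m = length N"
  define G where "G = NEPS (map complete_graph N) B"
  define P where "P s u v = (\<Prod>i<m. complete_idempotent (N ! i) (s i) (u ! i) (v ! i))"
    for s and u v :: "nat list"
  have V: "pverts G = {u. length u = m \<and> (\<forall>i<m. u ! i \<in> {..<N ! i})}"
    unfolding G_def m_def by (rule pverts_NEPS_complete)
  have vV: "v \<in> pverts G"
    using v by (simp add: G_def)
  \<comment> \<open>Matrix entry and idempotent are both products over the coordinates, so the sum
    over all vertices splits into one eigenvalue equation per complete graph.\<close>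
  have tensor: "(\<Sum>w\<in>pverts G. (\<Prod>i<m. if a ! i = 1 then of_bool (x ! i \<noteq> w ! i) else of_bool (x ! i = w ! i)) * P s w v)
      = of_int (tensor_eigenvalue N a s) * P s x v" if x: "x \<in> pverts G" for a s x
  proof -
    have "(\<Sum>w\<in>pverts G. (\<Prod>i<m. if a ! i = 1 then of_bool (x ! i \<noteq> w ! i) else of_bool (x ! i = w ! i)) * P s w v)
        = (\<Sum>w\<in>pverts G. \<Prod>i<m. (if a ! i = 1 then of_bool (x ! i \<noteq> w ! i) else of_bool (x ! i = w ! i))
            * complete_idempotent (N ! i) (s i) (w ! i) (v ! i))"
      by (simp add: P_def prod.distrib)
    also have "\<dots> = (\<Prod>i<m. \<Sum>z<N ! i. (if a ! i = 1 then of_bool (x ! i \<noteq> z) else of_bool (x ! i = z))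
            * complete_idempotent (N ! i) (s i) z (v ! i))"
      unfolding V by (rule sum_lists_prod) simp
    also have "\<dots> = (\<Prod>i<m. of_int (if a ! i = 1 then complete_eigenvalue (N ! i) (s i) else 1)
            * complete_idempotent (N ! i) (s i) (x ! i) (v ! i))"
    proof (rule prod.cong)
      fix i assume "i \<in> {..<m}"
      then have "x ! i < N ! i" "v ! i < N ! i"
        using x vV by (auto simp: V)
      then show "(\<Sum>z<N ! i. (if a ! i = 1 then of_bool (x ! i \<noteq> z) else of_bool (x ! i = z))
            * complete_idempotent (N ! i) (s i) z (v ! i))
          = of_int (if a ! i = 1 then complete_eigenvalue (N ! i) (s i) else 1)
            * complete_idempotent (N ! i) (s i) (x ! i) (v ! i)"
        using complete_idempotent_eigen[of "x ! i" "N ! i" "v ! i" "s i"]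
        by (auto simp: of_bool_def if_distrib[of "\<lambda>z. z * _"] cong: if_cong)
    qed simp
    finally show ?thesis
      by (simp add: P_def tensor_eigenvalue_def prod.distrib m_def of_int_prod)
  qed
  have "mat_exp_on (pverts G) (\<lambda>x w. - \<i> * of_real t * adj_matrix G x w) u v
      = (\<Sum>s\<in>PiE {..<m} (\<lambda>_. UNIV). exp (- \<i> * of_real t * of_int (NEPS_eigenvalue N B s)) * P s u v)"
  proof (rule mat_exp_on_spectral)
    show "finite (PiE {..<m} (\<lambda>_. UNIV :: bool set))"
      by (intro finite_PiE) auto
    show "u \<in> pverts G"
      using u by (simp add: G_def)
    show "(\<Sum>w\<in>pverts G. - \<i> * of_real t * adj_matrix G x w * P s w v)
        = - \<i> * of_real t * of_int (NEPS_eigenvalue N B s) * P s x v" if x: "x \<in> pverts G" for s x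
    proof -
      have "(\<Sum>w\<in>pverts G. adj_matrix G x w * P s w v)
          = (\<Sum>w\<in>pverts G. \<Sum>a\<in>B. (\<Prod>i<m. if a ! i = 1 then of_bool (x ! i \<noteq> w ! i) else of_bool (x ! i = w ! i)) * P s w v)"
        using x unfolding G_def m_def
        by (intro sum.cong) (simp_all add: adj_matrix_NEPS_complete[OF B] sum_distrib_right)
      also have "\<dots> = of_int (NEPS_eigenvalue N B s) * P s x v"
        by (subst sum.swap) (simp add: tensor[OF x] NEPS_eigenvalue_def sum_distrib_right)
      finally show ?thesis
        by (simp add: sum_distrib_left[symmetric] sum_negf mult.assoc)
    qed
    \<comment> \<open>In every coordinate the two idempotents add up to the identity.\<close>
    show "(\<Sum>s\<in>PiE {..<m} (\<lambda>_. UNIV). P s x v) = of_bool (x = v)" if x: "x \<in> pverts G" for x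
    proof -
      have "(\<Sum>s\<in>PiE {..<m} (\<lambda>_. UNIV). P s x v)
          = (\<Prod>i<m. \<Sum>b\<in>UNIV. complete_idempotent (N ! i) b (x ! i) (v ! i))"
        unfolding P_def by (subst prod_sum_PiE) auto
      also have "\<dots> = (\<Prod>i<m. of_bool (x ! i = v ! i))"
        by (simp add: UNIV_bool complete_idempotent_def)
      also have "\<dots> = of_bool (\<forall>i<m. x ! i = v ! i)"
        by (auto simp: of_bool_def prod_zero_iff)
      also have "(\<forall>i<m. x ! i = v ! i) \<longleftrightarrow> x = v"
        using x vV by (auto simp: V list_eq_iff_nth_eq)
      finally show ?thesis .
    qed
  qed
  then show ?thesis
    by (simp add: transition_matrix_def G_def P_def m_def)
qed

section \<open>From phases to translations of the vertices\<close>

text \<open>With these phases the spectral sum becomes \<open>g\<close> times the tensor product of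
  \<open>K\<^sub>2\<close> adjacency matrices where \<open>z\<close> is 1 and identities elsewhere.
  This is a permutation matrix, whose entry from \<open>u\<close> to its translate is 1.\<close>

lemma transition_matrix_translate:
  assumes B: "B \<subseteq> Z2_space (length N)"
    and u: "u \<in> pverts (NEPS (map complete_graph N) B)"
    and z: "\<And>i. i < length N \<Longrightarrow> z ! i = 1 \<Longrightarrow> N ! i = 2"
    and phase: "\<And>s. exp (- \<i> * of_real t * of_int (NEPS_eigenvalue N B s))
      = g * of_int (tensor_eigenvalue N z s)"
  shows "translate N u z \<in> pverts (NEPS (map complete_graph N) B)"
    and "transition_matrix (NEPS (map complete_graph N) B) t u (translate N u z) = g"
proof -
  have ui: "u ! i < N ! i" if "i < length N" for i
    using u that by (auto simp: pverts_NEPS_complete)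
  have vi: "translate N u z ! i = (u ! i + of_bool (z ! i = 1)) mod (N ! i)" if "i < length N" for i
    using that by (simp add: translate_def)
  show vV: "translate N u z \<in> pverts (NEPS (map complete_graph N) B)"
    using ui by (auto simp: pverts_NEPS_complete vi) (auto simp: translate_def intro: mod_less_divisor le_less_trans[OF le0])
  have "transition_matrix (NEPS (map complete_graph N) B) t u (translate N u z)
      = g * (\<Sum>s\<in>PiE {..<length N} (\<lambda>_. UNIV). \<Prod>i<length N.
          of_int (if z ! i = 1 then complete_eigenvalue (N ! i) (s i) else 1)
          * complete_idempotent (N ! i) (s i) (u ! i) (translate N u z ! i))"
    unfolding transition_matrix_NEPS_complete[OF B u vV] phase
    by (simp add: tensor_eigenvalue_def prod.distrib sum_distrib_left mult.assoc)
  also have "\<dots> = g * (\<Prod>i<length N. \<Sum>s\<in>UNIV.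
          of_int (if z ! i = 1 then complete_eigenvalue (N ! i) s else 1)
          * complete_idempotent (N ! i) s (u ! i) (translate N u z ! i))"
    by (subst prod_sum_PiE) auto
  also have "\<dots> = g"
  proof -
    \<comment> \<open>Where \<open>z\<close> is 1 the two vertices of \<open>K\<^sub>2\<close>
      differ and the sum is \<open>1/2 - (0 - 1/2)\<close>; elsewhere the entries agree and it is
      \<open>1/n + (1 - 1/n)\<close>.\<close>
    have "(\<Sum>s\<in>UNIV. of_int (if z ! i = 1 then complete_eigenvalue (N ! i) s else 1)
          * complete_idempotent (N ! i) s (u ! i) (translate N u z ! i)) = (1 :: complex)"
      if i: "i < length N" for i
    proof (cases "z ! i = 1")
      case True
      then have "N ! i = 2" "u ! i < 2" "translate N u z ! i = (u ! i + 1) mod 2"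
        using z[OF i] ui[OF i] vi[OF i] by auto
      moreover from this have "u ! i \<noteq> translate N u z ! i"
        by presburger
      ultimately show ?thesis
        using True by (simp add: UNIV_bool complete_idempotent_def)
    next
      case False
      then show ?thesis
        using ui[OF i] vi[OF i] by (simp add: UNIV_bool complete_idempotent_def)
    qed
    then show ?thesis by simp
  qed
  finally show "transition_matrix (NEPS (map complete_graph N) B) t u (translate N u z) = g" .
qed

text \<open>One phase condition serves both conclusions: a nonzero \<open>z\<close> moves every
  vertex, having a 1 in some coordinate of modulus 2, while the zero vector fixes every
  vertex.\<close>

lemma NEPS_complete_transfer:
  assumes B: "B \<subseteq> Z2_space (length N)" and len: "length z = length N"
    and z: "\<And>i. i < length N \<Longrightarrow> z ! i = 1 \<Longrightarrow> N ! i = 2"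
    and g: "norm g = 1"
    and phase: "\<And>s. exp (- \<i> * of_real t * of_int (NEPS_eigenvalue N B s))
      = g * of_int (tensor_eigenvalue N z s)"
  shows "z \<noteq> Z2_zero (length N) \<Longrightarrow> u \<in> pverts (NEPS (map complete_graph N) B) \<Longrightarrow>
      PST (NEPS (map complete_graph N) B) u (translate N u z) t"
    and "z = Z2_zero (length N) \<Longrightarrow> periodic_graph (NEPS (map complete_graph N) B) t"
proof -
  note H = transition_matrix_translate[OF B _ z phase]
  show "PST (NEPS (map complete_graph N) B) u (translate N u z) t"
    if nz: "z \<noteq> Z2_zero (length N)" and u: "u \<in> pverts (NEPS (map complete_graph N) B)"
  proof -
    obtain i where i: "i < length N" "z ! i = 1"
      using nz len by (auto simp: Z2_zero_def list_eq_iff_nth_eq)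
    then have "u ! i < 2" "translate N u z ! i = (u ! i + 1) mod 2"
      using u z[OF i] by (auto simp: pverts_NEPS_complete translate_def)
    then have "u ! i \<noteq> translate N u z ! i"
      by presburger
    then have "u \<noteq> translate N u z"
      by metis
    then show ?thesis
      using H[OF u] u g by (simp add: PST_def)
  qed
  show "periodic_graph (NEPS (map complete_graph N) B) t" if z0: "z = Z2_zero (length N)"
    unfolding periodic_graph_def
  proof
    fix u assume u: "u \<in> pverts (NEPS (map complete_graph N) B)"
    then have "translate N u z = u"
      by (auto simp: translate_def z0 Z2_zero_def pverts_NEPS_complete intro!: nth_equalityI)
    then show "norm (transition_matrix (NEPS (map complete_graph N) B) t u u) = 1"
      using H[OF u] g by simp
  qed
qed

section \<open>Parity and characters of tensor eigenvalues\<close>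

lemma tensor_eigenvalue_zero: "tensor_eigenvalue N (Z2_zero (length N)) s = 1"
  by (auto simp: tensor_eigenvalue_def Z2_zero_def intro!: prod.neutral)

lemma odd_tensor_eigenvalue:
  assumes "\<forall>n\<in>set N. even n"
  shows "odd (tensor_eigenvalue N a s)"
  using assms by (auto simp: tensor_eigenvalue_def even_prod_iff complete_eigenvalue_def)

lemma tensor_eigenvalue_append:
  assumes "length x = length M + length N"
  shows "tensor_eigenvalue (M @ N) x s
    = tensor_eigenvalue M (take (length M) x) s * tensor_eigenvalue N (drop (length M) x) (\<lambda>i. s (length M + i))"
proof -
  have split: "(\<Prod>i<k + l. f i) = (\<Prod>i<k. f i) * (\<Prod>i<l. f (k + i))" for f :: "nat \<Rightarrow> int" and k l
    by (induction l) (simp_all add: mult.assoc)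
  show ?thesis
    using assms by (simp add: tensor_eigenvalue_def split nth_append cong: if_cong)
qed

lemma tensor_eigenvalue_K2_cases:
  "tensor_eigenvalue (replicate r 2) y t = 1 \<or> tensor_eigenvalue (replicate r 2) y t = - 1"
proof -
  have "\<bar>tensor_eigenvalue (replicate r 2) y t\<bar> = 1"
    by (auto simp: tensor_eigenvalue_def abs_prod intro!: prod.neutral)
  then show ?thesis by linarith
qed

text \<open>Characters turn addition modulo 2 into multiplication. The map \<open>f\<close> makes
  room for repeated vectors: the lemma is applied to the elements of a fibre and also to
  \<open>drop d\<close> on all of \<open>A\<close>.\<close>

lemma prod_tensor_eigenvalue_K2:
  fixes f :: "'a \<Rightarrow> bit list"
  assumes "finite F"
  shows "(\<Prod>x\<in>F. tensor_eigenvalue (replicate r 2) (f x) t)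
    = tensor_eigenvalue (replicate r 2) (map (\<lambda>i. \<Sum>x\<in>F. f x ! i) [0..<r]) t"
proof -
  \<comment> \<open>Since \<open>e\<close> squares to 1, only the parity of the number of factors
    \<open>e\<close> counts, and a sum of bits records just this parity.\<close>
  have "(\<Prod>x\<in>F. if f x ! i = 1 then e else 1) = (if (\<Sum>x\<in>F. f x ! i) = 1 then e else (1 :: int))"
    if "e * e = 1" for e i
    using assms
  proof (induction F)
    case (insert x F)
    then show ?case
      using that by (cases "f x ! i"; cases "\<Sum>x\<in>F. f x ! i") simp_all
  qed simp
  note * = this
  have "(\<Prod>x\<in>F. tensor_eigenvalue (replicate r 2) (f x) t)
      = (\<Prod>i<r. \<Prod>x\<in>F. if f x ! i = 1 then complete_eigenvalue 2 (t i) else 1)"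
    unfolding tensor_eigenvalue_def by (subst prod.swap) (auto intro!: prod.cong)
  also have "\<dots> = (\<Prod>i<r. if (\<Sum>x\<in>F. f x ! i) = 1 then complete_eigenvalue 2 (t i) else 1)"
    by (intro prod.cong refl *) simp
  also have "\<dots> = tensor_eigenvalue (replicate r 2) (map (\<lambda>i. \<Sum>x\<in>F. f x ! i) [0..<r]) t"
    unfolding tensor_eigenvalue_def by (auto intro!: prod.cong)
  finally show ?thesis .
qed

text \<open>For odd \<open>x\<close> and \<open>y\<close>, the product \<open>(1 - x) * (1 - y)\<close> is divisible by 4, so
  \<open>x \<mapsto> 1 - x\<close> turns products into sums modulo 4.\<close>

lemma sum_odd_cong_prod:
  fixes f :: "'a \<Rightarrow> int"
  assumes "finite F" "\<And>x. x \<in> F \<Longrightarrow> odd (f x)"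
  shows "[(\<Sum>x\<in>F. f x) = int (card F) - 1 + (\<Prod>x\<in>F. f x)] (mod 4)"
  using assms
proof (induction F)
  case (insert x F)
  have "odd (f x)" "odd (\<Prod>x\<in>F. f x)"
    using insert.prems insert.hyps by (auto simp: even_prod_iff)
  then obtain p q where p: "f x = 2 * p + 1" and q: "(\<Prod>x\<in>F. f x) = 2 * q + 1"
    by (meson oddE)
  obtain k where k: "(\<Sum>x\<in>F. f x) = int (card F) - 1 + (2 * q + 1) + 4 * k"
    using insert.IH insert.prems q by (metis cong_iff_lin cong_sym insertCI)
  have "(int (card (insert x F)) - 1 + (\<Prod>x\<in>insert x F. f x)) - (\<Sum>x\<in>insert x F. f x) = 4 * (p * q - k)"
    using insert.hyps by (simp add: p q k algebra_simps)
  then show ?case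
    by (metis cong_iff_dvd_diff cong_sym dvd_triv_left)
qed simp

section \<open>Phases and transfer at the times \<open>pi / 2\<close>, \<open>2 * pi\<close> and
  \<open>pi\<close>\<close>

text \<open>At time \<open>pi / 2\<close> a unit of the eigenvalue is a quarter turn, so multiples
  of 4 disappear. Flipping the sign \<open>x\<close> changes the exponent by \<open>2 * e\<close>
  units, an odd number of half turns, and so flips the sign of the phase.\<close>

lemma exp_quarter_turns:
  fixes C e x l :: int
  assumes "[l = C + e * x] (mod 4)" "odd e" "x = 1 \<or> x = - 1"
  shows "exp (- \<i> * of_real (pi / 2) * of_int l) = exp (- \<i> * of_real (pi / 2) * of_int (C + e)) * of_int x"
proof -
  have per: "exp (- \<i> * of_real (pi / 2) * of_int (D + 4 * k)) = exp (- \<i> * of_real (pi / 2) * of_int D)" for D k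
  proof -
    have "- \<i> * of_real (pi / 2) * of_int (D + 4 * k)
        = - \<i> * of_real (pi / 2) * of_int D + \<i> * (of_int (- k) * (of_real pi * 2))"
      by (simp add: algebra_simps)
    then show ?thesis by (simp only: exp_plus_2pin)
  qed
  obtain k where k: "l = C + e * x + 4 * k"
    using assms(1) by (metis cong_iff_lin cong_sym)
  show ?thesis
  proof (cases "x = 1")
    case True
    then show ?thesis by (simp only: k per mult_1_right) simp
  next
    case False
    then have x: "x = - 1" using assms(3) by simp
    obtain j where "e = 2 * j + 1" using assms(2) by (meson oddE)
    \<comment> \<open>For odd \<open>e\<close>, \<open>- e\<close> and \<open>e - 2\<close> agree
      modulo 4; the remaining 2 is a single half turn.\<close>
    then have "l = C + e - 2 + 4 * (k - j)" using k x by simp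
    then have "exp (- \<i> * of_real (pi / 2) * of_int l) = exp (- \<i> * of_real (pi / 2) * of_int (C + e - 2))"
      by (simp only: per)
    also have "- \<i> * of_real (pi / 2) * of_int (C + e - 2) = - \<i> * of_real (pi / 2) * of_int (C + e) + \<i> * of_real pi"
      by (simp add: algebra_simps)
    finally show ?thesis by (simp only: exp_add x) simp
  qed
qed

text \<open>Reduces the claims at \<open>pi / 2\<close> to a congruence modulo 4. The odd factor
  \<open>e\<close> leaves room for a sign contributed by the coordinates in
  \<open>ns\<close>.\<close>

lemma transfer_at_half_pi:
  assumes A: "A \<subseteq> Z2_space (d + r)" and ns: "length ns = d" and c: "length c = r" and e: "odd e"
    and cong: "\<And>s. [NEPS_eigenvalue (ns @ replicate r 2) A s
      = C + e * tensor_eigenvalue (replicate r 2) c (\<lambda>i. s (d + i))] (mod 4)"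
    and G: "G = NEPS (map complete_graph ns @ replicate r (complete_graph 2)) A"
  shows "(c \<noteq> Z2_zero r \<longrightarrow>
      (\<forall>u\<in>pverts G. PST G u (translate (ns @ replicate r 2) u (Z2_zero d @ c)) (pi / 2))) \<and>
    (c = Z2_zero r \<longrightarrow> periodic_graph G (pi / 2))"
proof -
  define N where "N = ns @ replicate r 2"
  define z where "z = Z2_zero d @ c"
  define g where "g = exp (- \<i> * of_real (pi / 2) * of_int (C + e))"
  have G': "G = NEPS (map complete_graph N) A"
    by (simp add: G N_def)
  have A': "A \<subseteq> Z2_space (length N)" and lenz: "length z = length N"
    using A ns c by (simp_all add: N_def z_def Z2_zero_def)
  have z2: "N ! i = 2" if "i < length N" "z ! i = 1" for i
    using that ns by (auto simp: N_def z_def nth_append Z2_zero_def split: if_splits)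
  \<comment> \<open>The \<open>d\<close> leading zeros of \<open>z\<close> contribute the factor 1,
    so the character of \<open>z\<close> sees the \<open>K\<^sub>2\<close> coordinates only.\<close>
  have tz: "tensor_eigenvalue N z s = tensor_eigenvalue (replicate r 2) c (\<lambda>i. s (d + i))" for s
  proof -
    have "length z = length ns + length (replicate r (2 :: nat))" "take d z = Z2_zero (length ns)" "drop d z = c"
      using ns c by (simp_all add: z_def Z2_zero_def)
    then show ?thesis
      using ns tensor_eigenvalue_zero[of ns] by (simp add: N_def tensor_eigenvalue_append)
  qed
  have phase: "exp (- \<i> * of_real (pi / 2) * of_int (NEPS_eigenvalue N A s)) = g * of_int (tensor_eigenvalue N z s)" for s
    unfolding g_def tz
    by (rule exp_quarter_turns[OF cong[folded N_def] e tensor_eigenvalue_K2_cases])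
  have g: "norm g = 1"
    by (simp add: g_def)
  have "z = Z2_zero (length N) \<longleftrightarrow> c = Z2_zero r"
    using ns by (simp add: z_def N_def Z2_zero_def replicate_add)
  then show ?thesis
    using NEPS_complete_transfer[OF A' lenz z2 g phase] by (simp add: G' N_def z_def)
qed

text \<open>The eigenvalues are integers, so all phases are 1, which is the character of the zero
  vector.\<close>

lemma periodic_NEPS_two_pi:
  assumes "B \<subseteq> Z2_space (length N)"
  shows "periodic_graph (NEPS (map complete_graph N) B) (2 * pi)"
proof -
  have "exp (- \<i> * of_real (2 * pi) * of_int (NEPS_eigenvalue N B s))
      = 1 * of_int (tensor_eigenvalue N (Z2_zero (length N)) s)" for s
    using exp_plus_2pin[of 0 "- NEPS_eigenvalue N B s"] by (simp add: tensor_eigenvalue_zero mult_ac)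
  from NEPS_complete_transfer(2)[OF assms _ _ _ this] show ?thesis
    by (simp add: Z2_zero_def)
qed

text \<open>For even moduli each tensor eigenvalue is odd, so all eigenvalues have the parity of
  \<open>card B\<close> and share the phase \<open>g\<close>.\<close>

lemma periodic_NEPS_pi:
  assumes B: "B \<subseteq> Z2_space (length N)" and N: "\<forall>n\<in>set N. even n"
  shows "periodic_graph (NEPS (map complete_graph N) B) pi"
proof -
  define g where "g = exp (- \<i> * of_real pi * of_nat (card B))"
  have "exp (- \<i> * of_real pi * of_int (NEPS_eigenvalue N B s))
      = g * of_int (tensor_eigenvalue N (Z2_zero (length N)) s)" for s
  proof -
    have "NEPS_eigenvalue N B s - int (card B) = (\<Sum>a\<in>B. tensor_eigenvalue N a s - 1)"
      by (simp add: NEPS_eigenvalue_def sum_subtractf)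
    moreover have "even (\<Sum>a\<in>B. tensor_eigenvalue N a s - 1)"
      using odd_tensor_eigenvalue[OF N] by (intro dvd_sum) simp
    ultimately obtain k where "NEPS_eigenvalue N B s = int (card B) + 2 * k"
      by (metis add_diff_cancel_left' diff_add_cancel add.commute evenE)
    then have "- \<i> * of_real pi * of_int (NEPS_eigenvalue N B s)
        = - \<i> * of_real pi * of_nat (card B) + \<i> * (of_int (- k) * (of_real pi * 2))"
      by (simp add: algebra_simps)
    then show ?thesis
      by (simp only: exp_plus_2pin g_def tensor_eigenvalue_zero) simp
  qed
  from NEPS_complete_transfer(2)[OF B _ _ _ this] show ?thesis
    by (simp add: Z2_zero_def g_def)
qed

section \<open>Eigenvalues modulo 4\<close>

lemma sum_fibres:
  assumes "finite A"
  shows "(\<Sum>x\<in>A. f (take d x) (drop d x)) = (\<Sum>a\<in>proj_first d A. \<Sum>y\<in>fibre d A a. f a y)"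
proof -
  have "(\<Sum>x\<in>{x \<in> A. take d x = a}. f (take d x) (drop d x)) = (\<Sum>y\<in>fibre d A a. f a y)" for a
    by (rule sum.reindex_bij_witness[where i = "\<lambda>y. a @ y" and j = "drop d"])
      (auto simp: fibre_def min_def)
  then show ?thesis
    using sum.image_gen[OF assms, of "\<lambda>x. f (take d x) (drop d x)" "take d"]
    by (simp add: proj_first_def)
qed

text \<open>Grouped by the first \<open>d\<close> coordinates, each fibre contributes a factor from
  \<open>ns\<close> times a sum of signs. Over a nonzero \<open>a\<close> the product of these signs
  is 1, so their sum is the size of the fibre modulo 4; \<open>par\<close> then removes the factor
  from \<open>ns\<close>. Only the zero fibre keeps a character. The coefficient \<open>1 *\<close>
  is the \<open>e\<close> of \<open>transfer_at_half_pi\<close>.\<close>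

lemma NEPS_eigenvalue_cong_fibres:
  fixes s :: "nat \<Rightarrow> bool"
  assumes A: "A \<subseteq> Z2_space (d + r)" and ns: "length ns = d"
    and fib: "\<And>a. a \<in> proj_first d A - {Z2_zero d} \<Longrightarrow>
      even (card (fibre d A a)) \<and> vec_sum r (fibre d A a) = Z2_zero r"
    and par: "(\<forall>a\<in>proj_first d A - {Z2_zero d}. 4 dvd card (fibre d A a)) \<or> (\<forall>n\<in>set ns. even n)"
  shows "[NEPS_eigenvalue (ns @ replicate r 2) A s
    = (\<Sum>a\<in>proj_first d A - {Z2_zero d}. int (card (fibre d A a))) + int (card (fibre d A (Z2_zero d))) - 1
      + 1 * tensor_eigenvalue (replicate r 2) (vec_sum r (fibre d A (Z2_zero d))) (\<lambda>i. s (d + i))] (mod 4)"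
proof -
  define \<mu> where "\<mu> a = tensor_eigenvalue ns a s" for a
  define \<theta> where "\<theta> y = tensor_eigenvalue (replicate r 2) y (\<lambda>i. s (d + i))" for y
  have finA: "finite A"
    using A by (rule finite_Z2_subset)
  have finF: "finite (fibre d A a)" for a
    using finA by (auto simp: fibre_def)
  have \<theta>: "[(\<Sum>y\<in>fibre d A a. \<theta> y) = int (card (fibre d A a)) - 1 + \<theta> (vec_sum r (fibre d A a))] (mod 4)" for a
  proof -
    have "odd (\<theta> y)" for y
      using odd_tensor_eigenvalue[of "replicate r 2"] by (simp add: \<theta>_def)
    moreover have "(\<Prod>y\<in>fibre d A a. \<theta> y) = \<theta> (vec_sum r (fibre d A a))"
      using prod_tensor_eigenvalue_K2[OF finF, where f = "\<lambda>y. y"] by (simp add: \<theta>_def vec_sum_def)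
    ultimately show ?thesis
      using sum_odd_cong_prod[OF finF, of a \<theta>] by simp
  qed
  have nonzero: "[\<mu> a * (\<Sum>y\<in>fibre d A a. \<theta> y) = int (card (fibre d A a))] (mod 4)"
    if a: "a \<in> proj_first d A - {Z2_zero d}" for a
  proof -
    have "\<theta> (vec_sum r (fibre d A a)) = 1"
      using fib[OF a] tensor_eigenvalue_zero[of "replicate r 2"] by (simp add: \<theta>_def)
    then have "[\<mu> a * (\<Sum>y\<in>fibre d A a. \<theta> y) = \<mu> a * int (card (fibre d A a))] (mod 4)"
      using cong_scalar_left[OF \<theta>[of a]] by simp
    \<comment> \<open>Either the fibre size supplies the whole factor 4, or the even fibre size and
      the even \<open>\<mu> a - 1\<close> supply a factor 2 each.\<close>
    moreover have "4 dvd (\<mu> a - 1) * int (card (fibre d A a))"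
    proof (cases "4 dvd card (fibre d A a)")
      case True
      then have "4 dvd int (card (fibre d A a))" by presburger
      then show ?thesis by simp
    next
      case False
      then have "\<forall>n\<in>set ns. even n" using par a by blast
      then have "2 dvd \<mu> a - 1" using odd_tensor_eigenvalue by (simp add: \<mu>_def)
      moreover have "2 dvd int (card (fibre d A a))" using fib[OF a] by simp
      ultimately have "2 * 2 dvd (\<mu> a - 1) * int (card (fibre d A a))" by (rule mult_dvd_mono)
      then show ?thesis by simp
    qed
    then have "[\<mu> a * int (card (fibre d A a)) = int (card (fibre d A a))] (mod 4)"
      by (simp add: cong_iff_dvd_diff algebra_simps)
    ultimately show ?thesis
      by (rule cong_trans)
  qed
  have "NEPS_eigenvalue (ns @ replicate r 2) A s = (\<Sum>x\<in>A. \<mu> (take d x) * \<theta> (drop d x))"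
    unfolding NEPS_eigenvalue_def
  proof (rule sum.cong)
    fix x assume "x \<in> A"
    then have "length x = length ns + length (replicate r (2 :: nat))"
      using A ns by (auto simp: Z2_space_def)
    then show "tensor_eigenvalue (ns @ replicate r 2) x s = \<mu> (take d x) * \<theta> (drop d x)"
      using ns by (simp add: tensor_eigenvalue_append \<mu>_def \<theta>_def)
  qed simp
  also have "\<dots> = (\<Sum>a\<in>proj_first d A. \<mu> a * (\<Sum>y\<in>fibre d A a. \<theta> y))"
    by (subst sum_fibres[OF finA]) (simp add: sum_distrib_left)
  also have "\<dots> = (\<Sum>a\<in>proj_first d A - {Z2_zero d}. \<mu> a * (\<Sum>y\<in>fibre d A a. \<theta> y)) + (\<Sum>y\<in>fibre d A (Z2_zero d). \<theta> y)"
  \<comment> \<open>If no element of \<open>A\<close> starts with \<open>d\<close> zeros, the zero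
    fibre is empty and its sum is 0.\<close>
  proof (cases "Z2_zero d \<in> proj_first d A")
    case True
    moreover have "finite (proj_first d A)" using finA by (simp add: proj_first_def)
    moreover have "\<mu> (Z2_zero d) = 1" using tensor_eigenvalue_zero[of ns] ns by (simp add: \<mu>_def)
    ultimately show ?thesis by (simp add: sum.remove)
  next
    case False
    then have "fibre d A (Z2_zero d) = {}" by (auto simp: fibre_def proj_first_def image_iff)
    then show ?thesis using False by simp
  qed
  finally have "NEPS_eigenvalue (ns @ replicate r 2) A s
      = (\<Sum>a\<in>proj_first d A - {Z2_zero d}. \<mu> a * (\<Sum>y\<in>fibre d A a. \<theta> y)) + (\<Sum>y\<in>fibre d A (Z2_zero d). \<theta> y)" .
  moreover have "[(\<Sum>a\<in>proj_first d A - {Z2_zero d}. \<mu> a * (\<Sum>y\<in>fibre d A a. \<theta> y))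
      = (\<Sum>a\<in>proj_first d A - {Z2_zero d}. int (card (fibre d A a)))] (mod 4)"
    by (rule cong_sum) (rule nonzero)
  ultimately show ?thesis
    using cong_add[OF _ \<theta>[of "Z2_zero d"]] by (fastforce simp: \<theta>_def algebra_simps)
qed

text \<open>If 4 divides \<open>n\<close>, the two eigenvalues \<open>n - 1\<close> and
  \<open>- 1\<close> of \<open>K\<^sub>n\<close> agree modulo 4. The coordinates in
  \<open>ns\<close> then contribute signs independent of \<open>s\<close>, collected in front of the
  character, and the sum over all of \<open>A\<close> becomes a product at once because every term
  is odd.\<close>

lemma NEPS_eigenvalue_cong_four_dvd:
  fixes s :: "nat \<Rightarrow> bool"
  assumes A: "A \<subseteq> Z2_space (d + r)" and ns: "length ns = d" and four: "\<forall>n\<in>set ns. 4 dvd n"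
  shows "[NEPS_eigenvalue (ns @ replicate r 2) A s
    = int (card A) - 1 + (\<Prod>x\<in>A. \<Prod>i<d. if x ! i = 1 then - 1 else 1)
      * tensor_eigenvalue (replicate r 2) (drop d (vec_sum (d + r) A)) (\<lambda>i. s (d + i))] (mod 4)"
proof -
  define N where "N = ns @ replicate r (2 :: nat)"
  define \<theta> where "\<theta> y = tensor_eigenvalue (replicate r 2) y (\<lambda>i. s (d + i))" for y
  have finA: "finite A"
    using A by (rule finite_Z2_subset)
  have "\<forall>n\<in>set N. even n"
    using four dvd_trans[of 2 "4 :: nat"] by (auto simp: N_def)
  then have sum: "[NEPS_eigenvalue N A s = int (card A) - 1 + (\<Prod>x\<in>A. tensor_eigenvalue N x s)] (mod 4)"
    unfolding NEPS_eigenvalue_def by (intro sum_odd_cong_prod finA odd_tensor_eigenvalue)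
  have factors: "[(\<Prod>x\<in>A. tensor_eigenvalue N x s)
      = (\<Prod>x\<in>A. (\<Prod>i<d. if x ! i = 1 then - 1 else 1) * \<theta> (drop d x))] (mod 4)"
  proof (rule cong_prod)
    fix x assume "x \<in> A"
    then have "length x = length ns + length (replicate r (2 :: nat))"
      using A ns by (auto simp: Z2_space_def)
    then have "tensor_eigenvalue N x s = tensor_eigenvalue ns (take d x) s * \<theta> (drop d x)"
      using ns by (simp add: N_def tensor_eigenvalue_append \<theta>_def)
    moreover have "[tensor_eigenvalue ns (take d x) s = (\<Prod>i<d. if x ! i = 1 then - 1 else 1)] (mod 4)"
      unfolding tensor_eigenvalue_def ns
    proof (rule cong_prod)
      fix i assume "i \<in> {..<d}"
      then have "4 dvd int (ns ! i)" "take d x ! i = x ! i"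
        using four ns by (auto simp: int_dvd_int_iff[of 4, simplified])
      then show "[(if take d x ! i = 1 then complete_eigenvalue (ns ! i) (s i) else 1) = (if x ! i = 1 then - 1 else 1)] (mod 4)"
        by (simp add: complete_eigenvalue_def cong_iff_dvd_diff)
    qed
    ultimately show "[tensor_eigenvalue N x s = (\<Prod>i<d. if x ! i = 1 then - 1 else 1) * \<theta> (drop d x)] (mod 4)"
      by (simp add: cong_scalar_right)
  qed
  have characters: "(\<Prod>x\<in>A. \<theta> (drop d x)) = \<theta> (drop d (vec_sum (d + r) A))"
  proof -
    have "(\<Sum>x\<in>A. drop d x ! i) = (\<Sum>x\<in>A. x ! (d + i))" for i
      using A by (intro sum.cong) (auto simp: Z2_space_def)
    then have "map (\<lambda>i. \<Sum>x\<in>A. drop d x ! i) [0..<r] = drop d (vec_sum (d + r) A)"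
      by (auto simp: vec_sum_def intro!: nth_equalityI)
    then show ?thesis
      unfolding \<theta>_def by (simp only: prod_tensor_eigenvalue_K2[OF finA])
  qed
  show ?thesis
    using cong_trans[OF sum cong_add[OF cong_refl factors]]
    by (simp only: prod.distrib characters[unfolded \<theta>_def] N_def \<theta>_def)
qed

section \<open>The cases of odd \<open>h\<close>, even \<open>h\<close> and
  \<open>4 dvd h\<close>\<close>

theorem theorem1p3:
  fixes d r h :: nat and ns :: "nat list" and A :: "bit list set"
    and b c :: "bit list" and G :: "nat list pair_pre_digraph"
  assumes "d \<ge> 1" and "r \<ge> 1"
    and "length ns = d" and "\<forall>n\<in>set ns. n \<ge> 3"
    and "A \<noteq> {}" and "A \<subseteq> Z2_space (d + r) - {Z2_zero (d + r)}"
    and "\<exists>a\<in>A. drop d a \<noteq> Z2_zero r"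
    and "\<exists>a\<in>A. take d a \<noteq> Z2_zero d"
    and "b = vec_sum (d + r) A"
    and "c = vec_sum r (fibre d A (Z2_zero d))"
    and "G = NEPS (map complete_graph ns @ replicate r (complete_graph 2)) A"
    and "h = Gcd (set ns)"
  shows
    "(odd h \<longrightarrow>
        periodic_graph G (2 * pi) \<and>
        ((\<forall>a\<in>proj_first d A - {Z2_zero d}.
            card (fibre d A a) mod 4 = 0 \<and> vec_sum r (fibre d A a) = Z2_zero r) \<longrightarrow>
          (c \<noteq> Z2_zero r \<longrightarrow>
            (\<forall>u\<in>pverts G. PST G u (translate (ns @ replicate r 2) u (Z2_zero d @ c)) (pi / 2))) \<and>
          (c = Z2_zero r \<longrightarrow> periodic_graph G (pi / 2)))) \<and>
     (even h \<longrightarrow>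
        periodic_graph G pi \<and>
        (\<not> 4 dvd h \<and>
         (\<forall>a\<in>proj_first d A - {Z2_zero d}.
            card (fibre d A a) mod 2 = 0 \<and> vec_sum r (fibre d A a) = Z2_zero r) \<longrightarrow>
          (c \<noteq> Z2_zero r \<longrightarrow>
            (\<forall>u\<in>pverts G. PST G u (translate (ns @ replicate r 2) u (Z2_zero d @ c)) (pi / 2))) \<and>
          (c = Z2_zero r \<longrightarrow> periodic_graph G (pi / 2)))) \<and>
     (4 dvd h \<longrightarrow>
        (drop d b \<noteq> Z2_zero r \<longrightarrow>
          (\<forall>u\<in>pverts G. PST G u (translate (ns @ replicate r 2) u (Z2_zero d @ drop d b)) (pi / 2))) \<and>
        (drop d b = Z2_zero r \<longrightarrow> periodic_graph G (pi / 2)))"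
proof -
  let ?N = "ns @ replicate r 2"
  have A: "A \<subseteq> Z2_space (d + r)" "A \<subseteq> Z2_space (length ?N)"
    using assms by auto
  have G: "G = NEPS (map complete_graph ?N) A"
    using assms by simp
  have h: "k dvd h \<longleftrightarrow> (\<forall>n\<in>set ns. k dvd n)" for k
    by (simp add: assms dvd_Gcd_iff)
  \<comment> \<open>Shared by (a) and (b): the second premise holds by its first alternative in (a)
    and by its second in (b).\<close>
  have fibres: "(c \<noteq> Z2_zero r \<longrightarrow> (\<forall>u\<in>pverts G. PST G u (translate ?N u (Z2_zero d @ c)) (pi / 2))) \<and>
      (c = Z2_zero r \<longrightarrow> periodic_graph G (pi / 2))"
    if "\<And>a. a \<in> proj_first d A - {Z2_zero d} \<Longrightarrow> even (card (fibre d A a)) \<and> vec_sum r (fibre d A a) = Z2_zero r"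
      and "(\<forall>a\<in>proj_first d A - {Z2_zero d}. 4 dvd card (fibre d A a)) \<or> (\<forall>n\<in>set ns. even n)"
    unfolding \<open>c = _\<close>
    by (rule transfer_at_half_pi[OF A(1) \<open>length ns = d\<close> _ _
          NEPS_eigenvalue_cong_fibres[OF A(1) \<open>length ns = d\<close> that] assms(11)])
      (simp_all add: vec_sum_def)
  have "periodic_graph G (2 * pi)"
    unfolding G using A(2) by (rule periodic_NEPS_two_pi)
  moreover have "periodic_graph G pi" if "even h"
    unfolding G using A(2) by (rule periodic_NEPS_pi) (use that h in auto)
  moreover have "(c \<noteq> Z2_zero r \<longrightarrow> (\<forall>u\<in>pverts G. PST G u (translate ?N u (Z2_zero d @ c)) (pi / 2))) \<and>
      (c = Z2_zero r \<longrightarrow> periodic_graph G (pi / 2))"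
    if four: "\<forall>a\<in>proj_first d A - {Z2_zero d}. card (fibre d A a) mod 4 = 0 \<and> vec_sum r (fibre d A a) = Z2_zero r"
  proof (rule fibres)
    show "even (card (fibre d A a)) \<and> vec_sum r (fibre d A a) = Z2_zero r"
      if "a \<in> proj_first d A - {Z2_zero d}" for a
    proof -
      have "card (fibre d A a) mod 4 = 0" "vec_sum r (fibre d A a) = Z2_zero r"
        using four that by auto
      then show ?thesis by presburger
    qed
  qed (use four in auto)
  moreover have "(c \<noteq> Z2_zero r \<longrightarrow> (\<forall>u\<in>pverts G. PST G u (translate ?N u (Z2_zero d @ c)) (pi / 2))) \<and>
      (c = Z2_zero r \<longrightarrow> periodic_graph G (pi / 2))"
    if "even h"
      and "\<forall>a\<in>proj_first d A - {Z2_zero d}. card (fibre d A a) mod 2 = 0 \<and> vec_sum r (fibre d A a) = Z2_zero r"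
    by (rule fibres) (use that h in auto)
  moreover have "(drop d b \<noteq> Z2_zero r \<longrightarrow> (\<forall>u\<in>pverts G. PST G u (translate ?N u (Z2_zero d @ drop d b)) (pi / 2))) \<and>
      (drop d b = Z2_zero r \<longrightarrow> periodic_graph G (pi / 2))" if "4 dvd h"
    unfolding \<open>b = _\<close>
    \<comment> \<open>Here \<open>e\<close> is the product of the signs from the coordinates in
      \<open>ns\<close>, odd as a product of odd factors.\<close>
    by (rule transfer_at_half_pi[OF A(1) \<open>length ns = d\<close> _ _
          NEPS_eigenvalue_cong_four_dvd[OF A(1) \<open>length ns = d\<close>] assms(11)])
      (use that h finite_Z2_subset[OF A(1)] in \<open>auto simp: vec_sum_def even_prod_iff\<close>)
  ultimately show ?thesis
    by blast
qed

end
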